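(* Let $\{\Phi_k\}$ be a sequence of set-valued mappings that represents an embeddable stochastic subgradient method. Suppose: (A) $f$ is path-differentiable with convex-valued conservative field $\mathcal D_f$; $c$ is path-differentiable with convex-valued conservative Jacobian $\mathcal D_c$; and $\inf_{x\in\mathcal X}f(x)>-\infty$. (B) Let $\{(x_k,y_k)\},\{\lambda_k\}$ be generated by the framework (ELM) described in the context, and suppose: (1) $\{(x_k,y_k)\}$ is uniformly bounded in $\mathcal X\times\mathbb R^q$; (2) there is a nonnegative sequence $\{\delta_k\}$ with $\lim_k\delta_k=0$ such that $d_k\in\mathcal D_f^{\delta_k}(x_k)$, $J_{c,k}\in\mathcal D_c^{\delta_k}(x_k)$ and $\|w_k-c(x_k)\|\le\delta_k$ for all $k\ge0$; (3) $\{\xi_k\}$ is uniformly bounded, $\eta_k>0$, $\lim_k\eta_k=0$, $\sum_{k=0}^\infty\eta_k=+\infty$, and for every $T>0$, $\lim_{i\to\infty}\sup_{i\le j\le\Lambda(\sigma_i+T)}\big\|\sum_{k=i}^j\eta_k\xi_{k+1}\big\|=0$; (4) there exist $0<\theta_{\min}\le\theta_{\max}<\beta$ with $\theta_{\min}\le\theta_k\le\theta_{\max}$ for all $k\ge0$. Then for any sequence of indices $\{k_j:j\ge0\}$ with $k_j\to+\infty$ and $\lim_{j\to\infty}x_{k_j}=\bar x$, $$\lim_{j\to\infty}\mathrm{dist}\big(d_{k_j}+J_{c,k_j}(\lambda_{k_j}+\rho w_{k_j}),\ \mathcal D_g(\bar x)\big)=0.$$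
   Context: Setting: $\mathcal X\subseteq\mathbb R^n$ is a (nonempty) closed convex set, $f:\mathbb R^n\to\mathbb R$ and $c:\mathbb R^n\to\mathbb R^p$ are locally Lipschitz. $\mathcal N_{\mathcal X}(x)$ is the normal cone of $\mathcal X$ at $x\in\mathcal X$. Conservative Jacobian: for a locally Lipschitz $H:\mathbb R^n\to\mathbb R^s$, a set-valued $\mathcal D_H:\mathbb R^n\rightrightarrows\mathbb R^{n\times s}$ that is nonempty-valued, locally bounded, graph-closed, and such that for every absolutely continuous curve $\gamma:\mathbb R_+\to\mathbb R^n$, for almost every $t$, $\frac{d(H\circ\gamma)}{dt}(t)=J^\top\dot\gamma(t)$ for all $J\in\mathcal D_H(\gamma(t))$. For $s=1$ it is called a conservative field. $H$ is path-differentiable if it is locally Lipschitz and admits a conservative Jacobian. $\delta$-expansion: $\mathcal D^\delta(x)=\{w:\exists z,\ \|z-x\|\le\delta,\ \mathrm{dist}(w,\mathcal D(z))\le\delta\}$. For positive stepsizes $\{\eta_k\}$: $\sigma_0=0$, $\sigma_i=\sum_{k=0}^{i-1}\eta_k$, $\Lambda(t)=\sup\{k\ge0:\sigma_k\le t\}$. Parameters $\beta>0$, $\rho\ge0$. $\mathrm{regu}(y)=y/\|y\|$ if $y\ne0$ and $\mathrm{regu}(0)=0$. $\mathcal T_{regu}(y)=\{y/\|y\|\}$ if $y\neq0$ and $\mathcal T_{regu}(0)=\{u\in\mathbb R^p:\|u\|\le1\}$. $\mathcal D_g(x)=\mathrm{conv}\big(\mathcal D_f(x)+\mathcal D_c(x)(\beta\mathcal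 T_{regu}(c(x))+\rho c(x))\big)$, where $\mathcal W\mathcal Y=\{Wy:W\in\mathcal W,y\in\mathcal Y\}$. Embeddable stochastic subgradient method: set-valued mappings $\Phi_k:\mathbb R^n\times\mathcal X\times\mathbb R^q\times\mathbb R\rightrightarrows\mathcal X\times\mathbb R^q$, $k\ge0$, represent an embeddable stochastic subgradient method if (i) there is a locally bounded $T_\Phi:\mathbb R^n\times\mathcal X\times\mathbb R^q\to\mathbb R_+$ such that for all $(g,x,y,\eta)\in\mathbb R^n\times\mathcal X\times\mathbb R^q\times\mathbb R_+$, all $k\geq 0$ and all $(x',y')\in\Phi_k(g,x,y,\eta)$, $\|(x',y')-(x,y)\|\le\eta T_\Phi(g,x,y)$; and (ii) whenever $h:\mathbb R^n\to\mathbb R$ is path-differentiable with convex-valued conservative field $\mathcal D_h$, and $\{(x_k,y_k)\}$ satisfies $(x_{k+1},y_{k+1})\in\Phi_k(g_k,x_k,y_k,\eta_k)$ for all $k$, with: $\{h(x):x\in\mathcal X,0\in\mathcal D_h(x)+\mathcal N_{\mathcal X}(x)\}$ having empty interior in $\mathbb R$; $\{(x_k,y_k)\}$ uniformly bounded in $\mathcal X\times\mathbb R^q$; $g_k\in\mathcal D_h^{\delta_k}(x_k)+\xi_{k+1}$ for some nonnegative $\delta_k\to0$ and some $\{\xi_k\}\subset\mathbb R^n$; and $\eta_k>0$, $\eta_k\to0$, $\sum_k\eta_k=+\infty$, $\sup_k\|\xi_k\|<\infty$, $\lim_{i\to\infty}\sup_{i\le j\le\Lambda(\sigma_i+T)}\|\sum_{k=i}^j\eta_k\xi_{k+1}\|=0$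 for every $T>0$; then every cluster point of $\{x_k\}$ lies in $\{x\in\mathcal X:0\in\mathcal D_h(x)+\mathcal N_{\mathcal X}(x)\}$ and $\{h(x_k)\}$ converges. Framework (ELM): starting from some $x_0\in\mathcal X$, $y_0\in\mathbb R^q$, $w_0,\lambda_0\in\mathbb R^p$, for $k\ge0$: $l_{x,k}=d_k+J_{c,k}(\lambda_k+\rho w_k)+\xi_{k+1}$; $(x_{k+1},y_{k+1})\in\Phi_k(l_{x,k},x_k,y_k,\eta_k)$; $w_{k+1}\in\mathbb R^p$ is an approximate evaluation of $c(x_{k+1})$; $\lambda_{k+1}=\lambda_k+\theta_k(\mathrm{regu}(w_{k+1})-\frac1\beta\lambda_k)$. Here $d_k\in\mathbb R^n$, $J_{c,k}\in\mathbb R^{n\times p}$, $\xi_{k+1}\in\mathbb R^n$. *)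

theory Defs
  imports "HOL-Analysis.Analysis"
begin

definition locally_lipschitz :: "('a::metric_space \<Rightarrow> 'b::metric_space) \<Rightarrow> bool" where
  "locally_lipschitz H \<longleftrightarrow> (\<forall>x. \<exists>u>0. \<exists>L. L-lipschitz_on (ball x u) H)"

definition absolutely_continuous_on_interval ::
    "real \<Rightarrow> real \<Rightarrow> (real \<Rightarrow> 'a::real_normed_vector) \<Rightarrow> bool" where
  "absolutely_continuous_on_interval a b \<gamma> \<longleftrightarrow>
     (\<forall>\<epsilon>>0. \<exists>\<delta>>0. \<forall>(m::nat) s t.
        (\<forall>i<m. a \<le> s i \<and> s i \<le> t i \<and> t i \<le> b) \<and>
        disjoint_family_on (\<lambda>i. {s i<..<t i}) {..<m} \<and>
        (\<Sum>i<m. t i - s i) < \<delta>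
        \<longrightarrow> (\<Sum>i<m. norm (\<gamma> (t i) - \<gamma> (s i))) < \<epsilon>)"

(* Absolute continuity on [0, \<infinity>) is understood on compact subintervals: this is the class
   of curves with \<gamma> t = \<gamma> 0 + (integral of \<gamma>' over [0,t]) for all t \<ge> 0. *)
definition absolutely_continuous_curve :: "(real \<Rightarrow> 'a::real_normed_vector) \<Rightarrow> bool" where
  "absolutely_continuous_curve \<gamma> \<longleftrightarrow> (\<forall>b\<ge>0. absolutely_continuous_on_interval 0 b \<gamma>)"

(* Common part of conservative Jacobians and conservative fields. The map act gives the
   action of an element of D on a velocity: (J, v) \<mapsto> J\<^sup>T v for matrices, and the
   inner product when H is scalar. H is path-differentiable iff such a D exists; local
   Lipschitz continuity of H is part of the definition. *)
definition conservative_for ::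
    "('m::real_normed_vector \<Rightarrow> real^'n \<Rightarrow> 's::real_normed_vector) \<Rightarrow>
     (real^'n \<Rightarrow> 's) \<Rightarrow> (real^'n \<Rightarrow> 'm set) \<Rightarrow> bool" where
  "conservative_for act H D \<longleftrightarrow>
     locally_lipschitz H \<and>
     (\<forall>x. D x \<noteq> {}) \<and>
     (\<forall>x. \<exists>r>0. bounded (\<Union>z\<in>ball x r. D z)) \<and>
     closed {(x, w). w \<in> D x} \<and>
     (\<forall>\<gamma>. absolutely_continuous_curve \<gamma> \<longrightarrow>
        (AE t in lebesgue. 0 \<le> t \<longrightarrow>
          (\<exists>v. (\<gamma> has_vector_derivative v) (at t within {0..}) \<and>
            (\<forall>w\<in>D (\<gamma> t).
               ((\<lambda>s. H (\<gamma> s)) has_vector_derivative act w v) (at t within {0..})))))"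

(* n \<times> s matrices have type real^'s^'n, with the Frobenius norm. *)
definition conservative_jacobian ::
    "(real^'n \<Rightarrow> real^'s) \<Rightarrow> (real^'n \<Rightarrow> (real^'s^'n) set) \<Rightarrow> bool" where
  "conservative_jacobian = conservative_for (\<lambda>J v. transpose J *v v)"

definition conservative_field ::
    "(real^'n \<Rightarrow> real) \<Rightarrow> (real^'n \<Rightarrow> (real^'n) set) \<Rightarrow> bool" where
  "conservative_field = conservative_for (\<lambda>w v. w \<bullet> v)"

definition normal_cone :: "'a::real_inner set \<Rightarrow> 'a \<Rightarrow> 'a set" where
  "normal_cone X x = {v. \<forall>y\<in>X. v \<bullet> (y - x) \<le> 0}"

definition critical_points ::
    "(real^'n) set \<Rightarrow> (real^'n \<Rightarrow> (real^'n) set) \<Rightarrow> (real^'n) set" where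
  "critical_points X D = {x \<in> X. 0 \<in> D x + normal_cone X x}"

(* infdist equals the usual distance to a set only for nonempty sets; it is applied here
   to nonempty-valued D. *)
definition expansion ::
    "('a::real_normed_vector \<Rightarrow> 'm::real_normed_vector set) \<Rightarrow> real \<Rightarrow> 'a \<Rightarrow> 'm set" where
  "expansion D \<delta> x = {w. \<exists>z. norm (z - x) \<le> \<delta> \<and> infdist w (D z) \<le> \<delta>}"

definition step_sum :: "(nat \<Rightarrow> real) \<Rightarrow> nat \<Rightarrow> real" where
  "step_sum \<eta> i = (\<Sum>k<i. \<eta> k)"

(* The supremum is a genuine maximum for t \<ge> 0 when the stepsizes are positive and
   have divergent sum. *)
definition step_index :: "(nat \<Rightarrow> real) \<Rightarrow> real \<Rightarrow> nat" where
  "step_index \<eta> t = Sup {k. step_sum \<eta> k \<le> t}"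

definition admissible_steps_noise ::
    "(nat \<Rightarrow> real) \<Rightarrow> (nat \<Rightarrow> 'a::real_normed_vector) \<Rightarrow> bool" where
  "admissible_steps_noise \<eta> \<xi> \<longleftrightarrow>
     (\<forall>k. 0 < \<eta> k) \<and> \<eta> \<longlonglongrightarrow> 0 \<and>
     filterlim (step_sum \<eta>) at_top sequentially \<and>
     bounded (range \<xi>) \<and>
     (\<forall>T>0. (\<lambda>i. SUP j\<in>{i..step_index \<eta> (step_sum \<eta> i + T)}.
                norm (\<Sum>k=i..j. \<eta> k *\<^sub>R \<xi> (Suc k))) \<longlonglongrightarrow> 0)"

definition regu :: "'a::real_normed_vector \<Rightarrow> 'a" where
  "regu y = (if y = 0 then 0 else y /\<^sub>R norm y)"

definition regu_set :: "'a::real_normed_vector \<Rightarrow> 'a set" where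
  "regu_set y = (if y = 0 then {u. norm u \<le> 1} else {y /\<^sub>R norm y})"

definition penalty_field ::
    "real \<Rightarrow> real \<Rightarrow> (real^'n \<Rightarrow> real^'p) \<Rightarrow> (real^'n \<Rightarrow> (real^'n) set) \<Rightarrow>
     (real^'n \<Rightarrow> (real^'p^'n) set) \<Rightarrow> real^'n \<Rightarrow> (real^'n) set" where
  "penalty_field \<beta> \<rho> c D_f D_c x =
     convex hull (D_f x +
       {W *v y | W y. W \<in> D_c x \<and> y \<in> (\<lambda>u. \<beta> *\<^sub>R u + \<rho> *\<^sub>R c x) ` regu_set (c x)})"

(* Only the values of \<Phi> k g x y \<eta> with x \<in> X are meaningful; all conditions are
   relativised to X. *)
definition embeddable_method ::
    "(real^'n) set \<Rightarrow>
     (nat \<Rightarrow> real^'n \<Rightarrow> real^'n \<Rightarrow> real^'q \<Rightarrow> real \<Rightarrow> ((real^'n) \<times> (real^'q)) set) \<Rightarrow> bool" where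
  "embeddable_method X \<Phi> \<longleftrightarrow>
     (\<forall>k g y \<eta>. \<forall>x\<in>X. \<Phi> k g x y \<eta> \<subseteq> X \<times> UNIV) \<and>
     (\<exists>T :: (real^'n) \<times> (real^'n) \<times> (real^'q) \<Rightarrow> real.
        (\<forall>z\<in>UNIV \<times> X \<times> UNIV. 0 \<le> T z) \<and>
        (\<forall>z\<in>UNIV \<times> X \<times> UNIV. \<exists>r>0. bounded (T ` (ball z r \<inter> (UNIV \<times> X \<times> UNIV)))) \<and>
        (\<forall>k g y. \<forall>x\<in>X. \<forall>\<eta>\<ge>0. \<forall>(x', y')\<in>\<Phi> k g x y \<eta>.
           norm ((x', y') - (x, y)) \<le> \<eta> * T (g, x, y))) \<and>
     (\<forall>h D_h x y g \<eta> \<delta> \<xi>.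
        conservative_field h D_h \<and> (\<forall>z. convex (D_h z)) \<and>
        interior (h ` critical_points X D_h) = {} \<and>
        (\<forall>k. (x (Suc k), y (Suc k)) \<in> \<Phi> k (g k) (x k) (y k) (\<eta> k)) \<and>
        (\<forall>k. x k \<in> X) \<and> bounded (range (\<lambda>k. (x k, y k))) \<and>
        (\<forall>k. 0 \<le> \<delta> k) \<and> \<delta> \<longlonglongrightarrow> 0 \<and>
        (\<forall>k. g k \<in> (\<lambda>v. v + \<xi> (Suc k)) ` expansion D_h (\<delta> k) (x k)) \<and>
        admissible_steps_noise \<eta> \<xi>
        \<longrightarrow>
        (\<forall>r l. strict_mono (r :: nat \<Rightarrow> nat) \<and> (x \<circ> r) \<longlonglongrightarrow> l \<longrightarrow> l \<in> critical_points X D_h) \<and>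
        convergent (\<lambda>k. h (x k)))"

(* The requirement that w (Suc k) approximate c (x (Suc k)) carries no quantitative content
   by itself, hence c does not occur; the accuracy is a separate hypothesis. *)
definition elm_iterates ::
    "(real^'n) set \<Rightarrow>
     (nat \<Rightarrow> real^'n \<Rightarrow> real^'n \<Rightarrow> real^'q \<Rightarrow> real \<Rightarrow> ((real^'n) \<times> (real^'q)) set) \<Rightarrow>
     real \<Rightarrow> real \<Rightarrow> (nat \<Rightarrow> real) \<Rightarrow> (nat \<Rightarrow> real) \<Rightarrow>
     (nat \<Rightarrow> real^'n) \<Rightarrow> (nat \<Rightarrow> real^'p^'n) \<Rightarrow> (nat \<Rightarrow> real^'n) \<Rightarrow> (nat \<Rightarrow> real^'p) \<Rightarrow>
     (nat \<Rightarrow> real^'n) \<Rightarrow> (nat \<Rightarrow> real^'q) \<Rightarrow> (nat \<Rightarrow> real^'p) \<Rightarrow> bool" where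
  "elm_iterates X \<Phi> \<beta> \<rho> \<eta> \<theta> d J \<xi> w x y lam \<longleftrightarrow>
     x 0 \<in> X \<and>
     (\<forall>k. (x (Suc k), y (Suc k)) \<in>
            \<Phi> k (d k + J k *v (lam k + \<rho> *\<^sub>R w k) + \<xi> (Suc k)) (x k) (y k) (\<eta> k)) \<and>
     (\<forall>k. lam (Suc k) = lam k + \<theta> k *\<^sub>R (regu (w (Suc k)) - (1 / \<beta>) *\<^sub>R lam k))"

end

theory Submission
  imports Defs
begin

text \<open>
  A locally bounded set-valued map with closed graph is upper semicontinuous, so \<open>d\<close> and \<open>J\<close>
  approach \<open>D_f xbar\<close> and \<open>D_c xbar\<close> along the
  subsequence (\<open>expansion_tendsto\<close>). The real question is why the multiplier \<open>lam (idx j)\<close>, which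
  remembers all earlier values of \<open>w\<close>, approaches the set \<open>\<beta> \<cdot> regu_set (c xbar)\<close>.

  The multiplier update is a convex combination
  \<open>lam (k+1) = (1 - t) lam k + t (\<beta> regu (w (k+1)))\<close> with \<open>t = \<theta> k / \<beta>\<close> in
  \<open>[\<theta>_min / \<beta>, 1)\<close>. Since \<open>\<beta> \<cdot> regu_set (c xbar)\<close> is convex, the distance of \<open>lam\<close> to it
  contracts by the fixed factor \<open>1 - \<theta>_min / \<beta>\<close> per step, up to the distance of
  \<open>\<beta> regu (w (k+1))\<close>. The memory of the recursion is therefore effectively finite. The growth bound
  of an embeddable method together with the boundedness of all quantities gives
  \<open>x (k+1) - x k \<rightarrow> 0\<close>, so any finite window of iterates before \<open>idx j\<close> also converges to
  \<open>xbar\<close>, and on this window \<open>w\<close> tends to \<open>c xbar\<close>. As \<open>regu_set (c xbar)\<close> contains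
  every limit of \<open>regu\<close> at \<open>c xbar\<close>, the perturbations vanish on the window, and
  \<open>contraction_tendsto_along_subsequences\<close> yields the claim.
  Convexity of \<open>regu_set 0\<close>, the whole unit ball, is essential: there \<open>lam\<close> is in the limit an
  average of unit vectors \<open>regu (w k)\<close> whose directions need not settle.
\<close>

section \<open>Upper semicontinuity of locally bounded maps with closed graph\<close>

lemma obtain_near_infdist:
  assumes "A \<noteq> {}" "0 < e"
  obtains a where "a \<in> A" "dist x a < infdist x A + e"
proof -
  have "(INF a\<in>A. dist x a) < infdist x A + e"
    using assms by (simp add: infdist_notempty)
  then show thesis
    using that assms(1) cINF_less_iff[of A "dist x" "infdist x A + e"]
    by (auto simp: bdd_below_def intro: zero_le_dist)
qed

lemma obtain_nearby_sequence:
  fixes v :: "nat \<Rightarrow> 'a::real_normed_vector"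
  assumes "A \<noteq> {}" "(\<lambda>j. infdist (v j) A) \<longlonglongrightarrow> 0"
  obtains u where "\<forall>j. u j \<in> A" "(\<lambda>j. v j - u j) \<longlonglongrightarrow> 0"
proof -
  have "\<exists>a\<in>A. dist (v j) a < infdist (v j) A + 1 / real (Suc j)" for j
    using obtain_near_infdist[OF assms(1), of "1 / real (Suc j)" "v j"] by auto
  then obtain u where u: "\<And>j. u j \<in> A" "\<And>j. dist (v j) (u j) < infdist (v j) A + 1 / real (Suc j)"
    by metis
  have "(\<lambda>j. infdist (v j) A + 1 / real (Suc j)) \<longlonglongrightarrow> 0"
    using tendsto_add[OF assms(2) LIMSEQ_inverse_real_of_nat] by (simp add: inverse_eq_divide)
  then have "(\<lambda>j. v j - u j) \<longlonglongrightarrow> 0"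
    by (rule Lim_null_comparison[rotated])
      (use u(2) in \<open>auto intro!: always_eventually less_imp_le simp flip: dist_norm simp del: of_nat_Suc\<close>)
  with u(1) show thesis by (blast intro: that)
qed

text \<open>Compactness upgrades local boundedness to boundedness on bounded sets; closedness of the
  domain \<open>S\<close> is what makes the closure of a bounded part of \<open>S\<close> a compact part of \<open>S\<close>.\<close>

lemma locally_bounded_imp_bounded_UN:
  fixes F :: "'a::heine_borel \<Rightarrow> 'b::metric_space set"
  assumes loc: "\<And>z. z \<in> S \<Longrightarrow> \<exists>r>0. bounded (\<Union>z'\<in>ball z r \<inter> S. F z')"
    and "closed S" "bounded B" "B \<subseteq> S"
  shows "bounded (\<Union>z\<in>B. F z)"
proof -
  have cl: "compact (closure B)" "closure B \<subseteq> S"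
    using assms(2-4) by (auto simp: closure_minimal)
  have "\<forall>z\<in>S. \<exists>r. 0 < r \<and> bounded (\<Union>z'\<in>ball z r \<inter> S. F z')"
    using loc by (rule ballI)
  from bchoice[OF this] obtain r where
    r: "\<forall>z\<in>S. 0 < r z \<and> bounded (\<Union>z'\<in>ball z (r z) \<inter> S. F z')" ..
  have "z \<in> ball z (r z)" if "z \<in> closure B" for z
    using bspec[OF r subsetD[OF cl(2) that]] by simp
  then have "closure B \<subseteq> (\<Union>z\<in>closure B. ball z (r z))" by blast
  then obtain C where C: "C \<subseteq> closure B" "finite C" "closure B \<subseteq> (\<Union>z\<in>C. ball z (r z))"
    by (rule compactE_image[OF cl(1) open_ball])
  have "bounded (\<Union>z\<in>C. \<Union>z'\<in>ball z (r z) \<inter> S. F z')"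
    using bspec[OF r subsetD[OF cl(2) subsetD[OF C(1)]]] C(2) by (intro bounded_UN) auto
  moreover have "(\<Union>z\<in>B. F z) \<subseteq> (\<Union>z\<in>C. \<Union>z'\<in>ball z (r z) \<inter> S. F z')"
    using C(3) closure_subset[of B] \<open>B \<subseteq> S\<close> by blast
  ultimately show ?thesis by (rule bounded_subset)
qed

lemma closed_graph_imp_upper_semicontinuous:
  fixes D :: "'a::metric_space \<Rightarrow> 'b::heine_borel set"
  assumes cl: "closed {(x, w). w \<in> D x}"
    and bd: "\<exists>r>0. bounded (\<Union>z\<in>ball x r. D z)"
    and e: "0 < e"
  shows "\<exists>r>0. \<forall>z\<in>ball x r. \<forall>w\<in>D z. infdist w (D x) < e"
proof (rule ccontr)
  assume "\<not> ?thesis"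
  then have "\<exists>z w. z \<in> ball x (1 / real (Suc n)) \<and> w \<in> D z \<and> e \<le> infdist w (D x)" for n
    by (meson not_le of_nat_0_less_iff zero_less_Suc zero_less_divide_1_iff)
  then obtain z w where zw: "\<And>n. z n \<in> ball x (1 / real (Suc n))" "\<And>n. w n \<in> D (z n)"
      "\<And>n. e \<le> infdist (w n) (D x)"
    by metis
  have z: "z \<longlonglongrightarrow> x"
  proof (rule iffD2[OF tendsto_dist_iff], rule real_tendsto_sandwich[of "\<lambda>_. 0"])
    show "\<forall>\<^sub>F n in sequentially. dist (z n) x \<le> 1 / real (Suc n)"
      using zw(1) by (auto intro!: always_eventually simp: dist_commute less_imp_le)
    show "(\<lambda>n. 1 / real (Suc n)) \<longlonglongrightarrow> 0"
      using LIMSEQ_inverse_real_of_nat by (simp add: inverse_eq_divide)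
  qed auto
  obtain r where r: "0 < r" "bounded (\<Union>z\<in>ball x r. D z)" using bd by auto
  obtain N where N: "\<And>n. n \<ge> N \<Longrightarrow> z n \<in> ball x r"
    using tendstoD[OF z r(1)] by (auto simp: eventually_sequentially dist_commute)
  have "bounded (range (\<lambda>n. w (n + N)))"
    by (rule bounded_subset[OF r(2)]) (use N zw(2) in force)
  then obtain l s where s: "strict_mono s" "((\<lambda>n. w (n + N)) \<circ> s) \<longlonglongrightarrow> l"
    using bounded_imp_convergent_subsequence by blast
  have zs: "(\<lambda>n. z (s n + N)) \<longlonglongrightarrow> x"
    using LIMSEQ_subseq_LIMSEQ[OF LIMSEQ_ignore_initial_segment[OF z, of N] s(1)] by (simp add: o_def)
  have ws: "(\<lambda>n. w (s n + N)) \<longlonglongrightarrow> l" using s(2) by (simp add: o_def)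
  have "(x, l) \<in> {(x, w). w \<in> D x}"
    by (rule closed_sequentially[OF cl _ tendsto_Pair[OF zs ws]]) (use zw(2) in auto)
  then have "infdist l (D x) = 0" by simp
  moreover have "e \<le> infdist l (D x)"
    by (rule LIMSEQ_le_const[OF tendsto_infdist[OF ws]]) (use zw(3) in auto)
  ultimately show False using e by simp
qed

text \<open>The expansion moves both the base point and the value by at most \<open>\<delta> j\<close>; upper semicontinuity
  at \<open>l\<close> absorbs the first perturbation.\<close>

lemma expansion_tendsto:
  fixes D :: "'a::real_normed_vector \<Rightarrow> 'm::{real_normed_vector, heine_borel} set"
  assumes cl: "closed {(x, w). w \<in> D x}" and ne: "\<And>x. D x \<noteq> {}"
    and bd: "\<exists>r>0. bounded (\<Union>z\<in>ball l r. D z)"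
    and x: "x \<longlonglongrightarrow> l" and \<delta>: "\<delta> \<longlonglongrightarrow> 0"
    and v: "\<And>j. v j \<in> expansion D (\<delta> j) (x j)"
  shows "(\<lambda>j. infdist (v j) (D l)) \<longlonglongrightarrow> 0"
proof (rule LIMSEQ_I)
  fix e :: real assume e: "0 < e"
  obtain r where r: "0 < r" "\<And>z w. z \<in> ball l r \<Longrightarrow> w \<in> D z \<Longrightarrow> infdist w (D l) < e / 2"
    using closed_graph_imp_upper_semicontinuous[OF cl bd, of "e / 2"] e by auto
  have "\<forall>\<^sub>F j in sequentially. dist (x j) l < r / 2" "\<forall>\<^sub>F j in sequentially. \<delta> j < r / 2"
    "\<forall>\<^sub>F j in sequentially. \<delta> j < e / 4"
    using tendstoD[OF x, of "r / 2"] order_tendstoD(2)[OF \<delta>, of "r / 2"]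
      order_tendstoD(2)[OF \<delta>, of "e / 4"] r(1) e by auto
  then have "\<forall>\<^sub>F j in sequentially. norm (infdist (v j) (D l) - 0) < e"
  proof eventually_elim
    case (elim j)
    obtain z where z: "norm (z - x j) \<le> \<delta> j" "infdist (v j) (D z) \<le> \<delta> j"
      using v[of j] by (auto simp: expansion_def)
    have "dist l z \<le> dist (x j) l + dist (x j) z" by (metis dist_commute dist_triangle)
    then have "z \<in> ball l r" using z(1) elim by (auto simp: dist_norm norm_minus_commute)
    moreover obtain a where a: "a \<in> D z" "dist (v j) a < infdist (v j) (D z) + e / 4"
      using obtain_near_infdist[OF ne, of "e / 4"] e by auto
    ultimately have "infdist a (D l) < e / 2" using r(2) by blast
    then have "infdist (v j) (D l) < e"
      using infdist_triangle[of "v j" "D l" a] a z(2) elim by linarith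
    then show ?case by (simp add: infdist_nonneg)
  qed
  then show "\<exists>no. \<forall>n\<ge>no. norm (infdist (v n) (D l) - 0) < e"
    by (simp add: eventually_sequentially)
qed

lemma bounded_expansion_sequence:
  fixes D :: "'a::{real_normed_vector, heine_borel} \<Rightarrow> 'm::real_normed_vector set"
  assumes ne: "\<And>x. D x \<noteq> {}" and bd: "\<And>x. \<exists>r>0. bounded (\<Union>z\<in>ball x r. D z)"
    and x: "bounded (range x)" and \<delta>: "bounded (range \<delta>)"
    and v: "\<And>j. v j \<in> expansion D (\<delta> j) (x j)"
  shows "bounded (range v)"
proof -
  obtain z where z: "\<And>j. norm (z j - x j) \<le> \<delta> j" "\<And>j. infdist (v j) (D (z j)) \<le> \<delta> j"
    using v unfolding expansion_def mem_Collect_eq by metis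
  have "\<exists>a\<in>D (z j). dist (v j) a < infdist (v j) (D (z j)) + 1" for j
    using obtain_near_infdist[OF ne, of 1] by (metis zero_less_one)
  then obtain a where a: "\<And>j. a j \<in> D (z j)" "\<And>j. dist (v j) (a j) < infdist (v j) (D (z j)) + 1"
    by metis
  obtain K L where KL: "\<And>j. norm (x j) \<le> K" "\<And>j. \<bar>\<delta> j\<bar> \<le> L"
    using x \<delta> unfolding bounded_iff real_norm_def by blast
  have "norm (z j) \<le> K + L" for j
    using norm_triangle_ineq[of "x j" "z j - x j"] z(1)[of j] KL[of j] by simp
  then have "bounded (range z)" by (auto simp: bounded_iff)
  then have "bounded (\<Union>u\<in>range z. D u)"
    using bd by (intro locally_bounded_imp_bounded_UN[of UNIV]) auto
  then obtain M where M: "\<And>j. norm (a j) \<le> M" using a(1) unfolding bounded_iff by blast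
  have "norm (v j) \<le> M + L + 1" for j
    using norm_triangle_ineq[of "a j" "v j - a j"] a(2)[of j] z(2)[of j] M[of j] KL(2)[of j]
    by (simp add: dist_norm)
  then show ?thesis by (auto simp: bounded_iff)
qed

section \<open>The regularised direction\<close>

lemma norm_regu_le: "norm (regu y) \<le> 1"
  by (simp add: regu_def)

lemma regu_in_regu_set: "regu y \<in> regu_set y"
  by (simp add: regu_def regu_set_def)

lemma convex_regu_set: "convex (regu_set y)"
proof -
  have "{u. norm u \<le> 1} = cball (0::'a) 1" by auto
  then show ?thesis by (simp add: regu_set_def)
qed

text \<open>Off the origin \<open>regu\<close> is continuous; at the origin \<open>regu_set\<close> is the whole unit ball, which
  contains every value of \<open>regu\<close>.\<close>

lemma regu_tendsto_regu_set:
  assumes "w \<longlonglongrightarrow> y"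
  shows "(\<lambda>j. infdist (regu (w j)) (regu_set y)) \<longlonglongrightarrow> 0"
proof (cases "y = 0")
  case True
  then have "regu (w j) \<in> regu_set y" for j using norm_regu_le by (simp add: regu_set_def)
  then show ?thesis by simp
next
  case False
  have "(\<lambda>j. w j /\<^sub>R norm (w j)) \<longlonglongrightarrow> y /\<^sub>R norm y"
    using False by (intro tendsto_intros assms) auto
  moreover have "\<forall>\<^sub>F j in sequentially. w j /\<^sub>R norm (w j) = regu (w j)"
    using tendsto_imp_eventually_ne[OF assms False] by eventually_elim (simp add: regu_def)
  ultimately have "(\<lambda>j. regu (w j)) \<longlonglongrightarrow> y /\<^sub>R norm y"
    using tendsto_cong by fastforce
  then show ?thesis using False by (simp add: regu_set_def flip: tendsto_dist_iff)
qed

section \<open>Contractions with vanishing perturbation along subsequences\<close>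

lemma infdist_convex_combination:
  fixes S :: "'a::real_normed_vector set"
  assumes S: "convex S" "S \<noteq> {}" and t: "0 \<le> t" "t \<le> 1"
  shows "infdist ((1 - t) *\<^sub>R a + t *\<^sub>R b) S \<le> (1 - t) * infdist a S + t * infdist b S"
proof (rule field_le_epsilon)
  fix e :: real assume e: "0 < e"
  obtain p where p: "p \<in> S" "dist a p < infdist a S + e"
    by (rule obtain_near_infdist[OF S(2) e])
  obtain q where q: "q \<in> S" "dist b q < infdist b S + e"
    by (rule obtain_near_infdist[OF S(2) e])
  have "(1 - t) *\<^sub>R p + t *\<^sub>R q \<in> S" using S(1) p(1) q(1) t by (simp add: convex_alt)
  then have "infdist ((1 - t) *\<^sub>R a + t *\<^sub>R b) S
      \<le> dist ((1 - t) *\<^sub>R a + t *\<^sub>R b) ((1 - t) *\<^sub>R p + t *\<^sub>R q)"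
    by (rule infdist_le)
  also have "\<dots> = norm ((1 - t) *\<^sub>R (a - p) + t *\<^sub>R (b - q))"
    by (simp add: dist_norm algebra_simps)
  also have "\<dots> \<le> (1 - t) * dist a p + t * dist b q"
    using t by (intro norm_triangle_le) (simp add: dist_norm)
  also have "\<dots> \<le> (1 - t) * (infdist a S + e) + t * (infdist b S + e)"
    using t p(2) q(2) by (intro add_mono mult_left_mono) auto
  also have "\<dots> = (1 - t) * infdist a S + t * infdist b S + e" by (simp add: algebra_simps)
  finally show "infdist ((1 - t) *\<^sub>R a + t *\<^sub>R b) S \<le> (1 - t) * infdist a S + t * infdist b S + e" .
qed

text \<open>Unfolding the recursion \<open>m\<close> times from \<open>r j\<close> bounds \<open>a (r j)\<close> by \<open>q ^ m * M\<close> plus finitely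
  many perturbations. The induction on \<open>m\<close> quantifies over all index sequences \<open>r\<close> along which
  \<open>x\<close> tends to \<open>l\<close>: this family is closed under passing to the predecessors \<open>r j - 1\<close>, because
  consecutive terms of \<open>x\<close> merge.\<close>

lemma contraction_tendsto_along_subsequences:
  fixes a b :: "nat \<Rightarrow> real" and x :: "nat \<Rightarrow> 'a::real_normed_vector"
  assumes rec: "\<And>k. a (Suc k) \<le> q * a k + b (Suc k)" and q: "0 \<le> q" "q < 1"
    and a: "\<And>k. 0 \<le> a k" "\<And>k. a k \<le> M"
    and x: "(\<lambda>k. x (Suc k) - x k) \<longlonglongrightarrow> 0"
    and b: "\<And>r. filterlim r at_top sequentially \<Longrightarrow> (\<lambda>j. x (r j)) \<longlonglongrightarrow> l \<Longrightarrow> (\<lambda>j. b (r j)) \<longlonglongrightarrow> 0"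
    and r: "filterlim r at_top sequentially" "(\<lambda>j. x (r j)) \<longlonglongrightarrow> l"
  shows "(\<lambda>j. a (r j)) \<longlonglongrightarrow> 0"
proof -
  have window: "\<forall>\<^sub>F j in sequentially. a (r j) < q ^ m * M + e"
    if "filterlim r at_top sequentially" "(\<lambda>j. x (r j)) \<longlonglongrightarrow> l" "0 < e" for m r e
    using that
  proof (induction m arbitrary: r e)
    case 0
    then show ?case using a(2) by (auto intro!: always_eventually le_less_trans[OF a(2)])
  next
    case (Suc m)
    have pos: "\<forall>\<^sub>F j in sequentially. 0 < r j"
      using Suc.prems(1)[unfolded filterlim_at_top, rule_format, of 1] by eventually_elim simp
    have lim: "filterlim (\<lambda>j. r j - 1) at_top sequentially"
      using Suc.prems(1) filterlim_compose[OF filterlim_minus_const_nat_at_top] by blast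
    have "(\<lambda>j. x (r j) - (x (Suc (r j - 1)) - x (r j - 1))) \<longlonglongrightarrow> l - 0"
      by (intro tendsto_diff Suc.prems(2) filterlim_compose[OF x lim])
    moreover have "\<forall>\<^sub>F j in sequentially. x (r j) - (x (Suc (r j - 1)) - x (r j - 1)) = x (r j - 1)"
      using pos by eventually_elim simp
    ultimately have "(\<lambda>j. x (r j - 1)) \<longlonglongrightarrow> l"
      using tendsto_cong by fastforce
    from Suc.IH[OF lim this, of "e / 2"] Suc.prems(3)
    have "\<forall>\<^sub>F j in sequentially. a (r j - 1) < q ^ m * M + e / 2" by simp
    moreover have "\<forall>\<^sub>F j in sequentially. b (r j) < e / 2"
      using order_tendstoD(2)[OF b[OF Suc.prems(1,2)], of "e / 2"] Suc.prems(3) by simp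
    ultimately show ?case using pos
    proof eventually_elim
      case (elim j)
      have "a (r j) \<le> q * a (r j - 1) + b (r j)" using rec[of "r j - 1"] elim by simp
      also have "q * a (r j - 1) \<le> q * (q ^ m * M + e / 2)"
        using elim q by (intro mult_left_mono) auto
      also have "\<dots> \<le> q ^ Suc m * M + e / 2"
        using q Suc.prems(3) mult_right_mono[of q 1 "e / 2"] by (simp add: algebra_simps)
      finally show ?case using elim by simp
    qed
  qed
  show ?thesis
  proof (rule order_tendstoI)
    fix e :: real assume e: "0 < e"
    have "(\<lambda>m. q ^ m * M) \<longlonglongrightarrow> 0 * M"
      using q by (intro tendsto_intros LIMSEQ_power_zero) auto
    then have "\<forall>\<^sub>F m in sequentially. q ^ m * M < e / 2"
      using e by (intro order_tendstoD(2)) auto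
    then obtain m where "q ^ m * M < e / 2" by (auto simp: eventually_sequentially)
    with window[OF r, of "e / 2" m] e show "\<forall>\<^sub>F j in sequentially. a (r j) < e"
      by (auto elim!: eventually_mono)
  qed (intro always_eventually allI less_le_trans[OF _ a(1)])
qed

section \<open>The multipliers and the search directions\<close>

lemma bounded_bilinear_matrix_vector_mult:
  "bounded_bilinear ((*v) :: real^'m^'n \<Rightarrow> real^'m \<Rightarrow> real^'n)"
  by (intro bilinear_conv_bounded_bilinear[THEN iffD1])
    (auto simp: bilinear_def linear_iff algebra_simps scaleR_matrix_vector_assoc)

context
  fixes \<beta> \<theta>_min :: real and \<theta> :: "nat \<Rightarrow> real" and w lam :: "nat \<Rightarrow> 'a::real_normed_vector"
  assumes \<beta>: "0 < \<beta>" and \<theta>_min: "0 < \<theta>_min" "\<And>k. \<theta>_min \<le> \<theta> k" "\<And>k. \<theta> k \<le> \<beta>"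
    and lam: "\<And>k. lam (Suc k) = lam k + \<theta> k *\<^sub>R (regu (w (Suc k)) - (1 / \<beta>) *\<^sub>R lam k)"
begin

lemma multiplier_convex_combination:
  "lam (Suc k) = (1 - \<theta> k / \<beta>) *\<^sub>R lam k + (\<theta> k / \<beta>) *\<^sub>R (\<beta> *\<^sub>R regu (w (Suc k)))"
  using \<beta> by (simp add: lam algebra_simps)

lemma infdist_multiplier_step:
  assumes "convex S" "S \<noteq> {}"
  shows "infdist (lam (Suc k)) S
    \<le> (1 - \<theta>_min / \<beta>) * infdist (lam k) S + infdist (\<beta> *\<^sub>R regu (w (Suc k))) S"
proof -
  have t: "\<theta>_min / \<beta> \<le> \<theta> k / \<beta>" "0 \<le> \<theta> k / \<beta>" "\<theta> k / \<beta> \<le> 1"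
    using \<beta> \<theta>_min(1) \<theta>_min(2,3)[of k] by (auto simp: divide_right_mono)
  have "infdist (lam (Suc k)) S
      \<le> (1 - \<theta> k / \<beta>) * infdist (lam k) S + (\<theta> k / \<beta>) * infdist (\<beta> *\<^sub>R regu (w (Suc k))) S"
    unfolding multiplier_convex_combination
    by (rule infdist_convex_combination[OF assms t(2,3)])
  also have "\<dots> \<le> (1 - \<theta>_min / \<beta>) * infdist (lam k) S + 1 * infdist (\<beta> *\<^sub>R regu (w (Suc k))) S"
    using t by (intro add_mono mult_right_mono infdist_nonneg) auto
  finally show ?thesis by simp
qed

text \<open>A ball containing \<open>lam 0\<close> and all \<open>\<beta> regu w\<close> is convex, hence invariant under the
  update.\<close>

lemma bounded_multiplier: "bounded (range lam)"
proof -
  have "norm (lam k) \<le> max (norm (lam 0)) \<beta>" for k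
  proof (induction k)
    case (Suc k)
    have t: "0 \<le> \<theta> k / \<beta>" "\<theta> k / \<beta> \<le> 1"
      using \<beta> \<theta>_min(1) \<theta>_min(2,3)[of k] by auto
    have "lam (Suc k) \<in> cball 0 (max (norm (lam 0)) \<beta>)"
      unfolding multiplier_convex_combination
    proof (rule convexD[OF convex_cball])
      show "\<beta> *\<^sub>R regu (w (Suc k)) \<in> cball 0 (max (norm (lam 0)) \<beta>)"
        using \<beta> mult_left_mono[OF norm_regu_le[of "w (Suc k)"], of \<beta>] by (simp add: le_max_iff_disj)
    qed (use Suc t in auto)
    then show ?case by simp
  qed simp
  then show ?thesis by (auto simp: bounded_iff)
qed

lemma multiplier_tendsto:
  fixes x :: "nat \<Rightarrow> 'b::real_normed_vector"
  assumes x: "(\<lambda>k. x (Suc k) - x k) \<longlonglongrightarrow> 0"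
    and w: "\<And>r. filterlim r at_top sequentially \<Longrightarrow> (\<lambda>j. x (r j)) \<longlonglongrightarrow> l \<Longrightarrow> (\<lambda>j. w (r j)) \<longlonglongrightarrow> y"
    and r: "filterlim r at_top sequentially" "(\<lambda>j. x (r j)) \<longlonglongrightarrow> l"
  shows "(\<lambda>j. infdist (lam (r j)) ((*\<^sub>R) \<beta> ` regu_set y)) \<longlonglongrightarrow> 0"
proof -
  let ?S = "(*\<^sub>R) \<beta> ` regu_set y"
  have S: "convex ?S" "?S \<noteq> {}" "\<beta> *\<^sub>R regu y \<in> ?S"
    using regu_in_regu_set[of y] by (auto simp: convex_scaling convex_regu_set)
  obtain K where K: "\<And>k. norm (lam k) \<le> K" using bounded_multiplier by (auto simp: bounded_iff)
  have M: "infdist (lam k) ?S \<le> K + norm (\<beta> *\<^sub>R regu y)" for k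
    using K[of k] by (intro infdist_le2[OF S(3)]) (simp add: dist_norm norm_triangle_le_diff)
  have q: "0 \<le> 1 - \<theta>_min / \<beta>" "1 - \<theta>_min / \<beta> < 1"
    using \<beta> \<theta>_min(1) order_trans[OF \<theta>_min(2,3)[of 0]] by auto
  have b: "(\<lambda>j. infdist (\<beta> *\<^sub>R regu (w (r j))) ?S) \<longlonglongrightarrow> 0"
    if "filterlim r at_top sequentially" "(\<lambda>j. x (r j)) \<longlonglongrightarrow> l" for r
  proof -
    have "regu_set y \<noteq> {}" using regu_in_regu_set by blast
    from this regu_tendsto_regu_set[OF w[OF that]] obtain u where
      u: "\<forall>j. u j \<in> regu_set y" "(\<lambda>j. regu (w (r j)) - u j) \<longlonglongrightarrow> 0"
      by (rule obtain_nearby_sequence)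
    have "(\<lambda>j. norm (\<beta> *\<^sub>R (regu (w (r j)) - u j))) \<longlonglongrightarrow> norm (\<beta> *\<^sub>R (0::'a))"
      by (intro tendsto_intros u(2))
    then have "(\<lambda>j. norm (\<beta> *\<^sub>R (regu (w (r j)) - u j))) \<longlonglongrightarrow> 0" by simp
    then show ?thesis
    proof (rule Lim_null_comparison[rotated])
      have "infdist (\<beta> *\<^sub>R regu (w (r j))) ?S \<le> norm (\<beta> *\<^sub>R (regu (w (r j)) - u j))" for j
        using u(1) by (intro infdist_le2[of "\<beta> *\<^sub>R u j"]) (auto simp: dist_norm scaleR_diff_right)
      then show "\<forall>\<^sub>F j in sequentially. norm (infdist (\<beta> *\<^sub>R regu (w (r j))) ?S)
          \<le> norm (\<beta> *\<^sub>R (regu (w (r j)) - u j))"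
        by (intro always_eventually) (simp add: infdist_nonneg)
    qed
  qed
  show ?thesis
    by (rule contraction_tendsto_along_subsequences[where a = "\<lambda>k. infdist (lam k) ?S"
          and b = "\<lambda>k. infdist (\<beta> *\<^sub>R regu (w k)) ?S" and x = x and l = l,
          OF infdist_multiplier_step[OF S(1,2)] q infdist_nonneg M x b r])
qed

end

text \<open>The growth bound of the method is only locally bounded in its arguments, so it bounds the
  speed of the iterates once the directions and the iterates stay in a bounded set.\<close>

lemma embeddable_method_increments:
  assumes "embeddable_method X \<Phi>" "closed X"
    and step: "\<And>k. (x (Suc k), y (Suc k)) \<in> \<Phi> k (g k) (x k) (y k) (\<eta> k)"
    and x: "\<And>k. x k \<in> X" and bd: "bounded (range g)" "bounded (range (\<lambda>k. (x k, y k)))"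
    and \<eta>: "\<And>k. 0 \<le> \<eta> k" "\<eta> \<longlonglongrightarrow> 0"
  shows "(\<lambda>k. x (Suc k) - x k) \<longlonglongrightarrow> 0"
proof -
  let ?S = "UNIV \<times> X \<times> UNIV"
  obtain T where T: "\<forall>z\<in>?S. \<exists>r>0. bounded (T ` (ball z r \<inter> ?S))"
      "\<forall>k g y. \<forall>x\<in>X. \<forall>\<eta>\<ge>0. \<forall>(x', y')\<in>\<Phi> k g x y \<eta>. norm ((x', y') - (x, y)) \<le> \<eta> * T (g, x, y)"
    using assms(1)[unfolded embeddable_method_def, THEN conjunct2, THEN conjunct1]
    by (elim exE conjE) (rule that; assumption)
  have "bounded (\<Union>z\<in>range (\<lambda>k. (g k, x k, y k)). {T z})"
  proof (rule locally_bounded_imp_bounded_UN[of ?S])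
    show "\<exists>r>0. bounded (\<Union>z'\<in>ball z r \<inter> ?S. {T z'})" if "z \<in> ?S" for z
      using T(1) that by (auto simp: UNION_singleton_eq_range)
    show "closed ?S" using \<open>closed X\<close> by (intro closed_Times) auto
    show "bounded (range (\<lambda>k. (g k, x k, y k)))"
      by (rule bounded_subset[OF bounded_Times[OF bd]]) auto
  qed (use x in auto)
  then obtain M where M: "\<And>k. \<bar>T (g k, x k, y k)\<bar> \<le> M"
    unfolding bounded_iff real_norm_def by blast
  have "norm (x (Suc k) - x k) \<le> \<eta> k * M" for k
  proof -
    have "norm (x (Suc k) - x k) \<le> norm ((x (Suc k), y (Suc k)) - (x k, y k))"
      using norm_fst_le[of "x (Suc k) - x k" "y (Suc k) - y k"] by simp
    also have "\<dots> \<le> \<eta> k * T (g k, x k, y k)" 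
      using T(2)[rule_format, OF x[of k] \<eta>(1)[of k] step[of k]] by simp
    also have "\<dots> \<le> \<eta> k * M" using M[of k] \<eta>(1)[of k] by (intro mult_left_mono) auto
    finally show ?thesis .
  qed
  moreover have "(\<lambda>k. \<eta> k * M) \<longlonglongrightarrow> 0" using tendsto_mult_left_zero[OF \<eta>(2)] .
  ultimately show ?thesis by (rule Lim_null_comparison[OF always_eventually[OF allI]])
qed

lemma locally_lipschitz_tendsto:
  assumes "locally_lipschitz H" "u \<longlonglongrightarrow> l"
  shows "(\<lambda>j. H (u j)) \<longlonglongrightarrow> H l"
proof -
  obtain r L where "0 < r" "L-lipschitz_on (ball l r) H"
    using assms(1) unfolding locally_lipschitz_def by blast
  then have "isCont H l"
    using lipschitz_on_continuous_on continuous_on_eq_continuous_at[OF open_ball] centre_in_ball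
    by blast
  then show ?thesis using assms(2) isCont_tendsto_compose by blast
qed

theorem propositionA3:
  fixes X :: "(real^'n) set"
    and f :: "real^'n \<Rightarrow> real"
    and c :: "real^'n \<Rightarrow> real^'p"
    and D_f :: "real^'n \<Rightarrow> (real^'n) set"
    and D_c :: "real^'n \<Rightarrow> (real^'p^'n) set"
    and \<Phi> :: "nat \<Rightarrow> real^'n \<Rightarrow> real^'n \<Rightarrow> real^'q \<Rightarrow> real \<Rightarrow> ((real^'n) \<times> (real^'q)) set"
    and \<beta> \<rho> \<theta>_min \<theta>_max :: real
    and \<eta> \<theta> \<delta> :: "nat \<Rightarrow> real"
    and d \<xi> x :: "nat \<Rightarrow> real^'n"
    and J :: "nat \<Rightarrow> real^'p^'n"
    and w lam :: "nat \<Rightarrow> real^'p"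
    and y :: "nat \<Rightarrow> real^'q"
    and idx :: "nat \<Rightarrow> nat"
    and xbar :: "real^'n"
  assumes "X \<noteq> {}" "closed X" "convex X"
    and "0 < \<beta>" "0 \<le> \<rho>"
    and "embeddable_method X \<Phi>"
    and "conservative_field f D_f" "\<forall>z. convex (D_f z)"
    and "conservative_jacobian c D_c" "\<forall>z. convex (D_c z)"
    and "bdd_below (f ` X)"
    and "elm_iterates X \<Phi> \<beta> \<rho> \<eta> \<theta> d J \<xi> w x y lam"
    and "\<forall>k. x k \<in> X" "bounded (range (\<lambda>k. (x k, y k)))"
    and "\<forall>k. 0 \<le> \<delta> k" "\<delta> \<longlonglongrightarrow> 0"
    and "\<forall>k. d k \<in> expansion D_f (\<delta> k) (x k)"
    and "\<forall>k. J k \<in> expansion D_c (\<delta> k) (x k)"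
    and "\<forall>k. norm (w k - c (x k)) \<le> \<delta> k"
    and "admissible_steps_noise \<eta> \<xi>"
    and "0 < \<theta>_min" "\<theta>_min \<le> \<theta>_max" "\<theta>_max < \<beta>"
    and "\<forall>k. \<theta>_min \<le> \<theta> k \<and> \<theta> k \<le> \<theta>_max"
    and "filterlim idx at_top sequentially"
    and "(\<lambda>j. x (idx j)) \<longlonglongrightarrow> xbar"
  shows "(\<lambda>j. infdist (d (idx j) + J (idx j) *v (lam (idx j) + \<rho> *\<^sub>R w (idx j)))
               (penalty_field \<beta> \<rho> c D_f D_c xbar)) \<longlonglongrightarrow> 0"
proof -
  have c: "locally_lipschitz c"
    using assms(9) unfolding conservative_jacobian_def conservative_for_def by (rule conjunct1)
  have D_f: "\<And>z. D_f z \<noteq> {}" "\<And>z. \<exists>r>0. bounded (\<Union>u\<in>ball z r. D_f u)" "closed {(z, u). u \<in> D_f z}"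
    using assms(7) unfolding conservative_field_def conservative_for_def by simp_all
  have D_c: "\<And>z. D_c z \<noteq> {}" "\<And>z. \<exists>r>0. bounded (\<Union>u\<in>ball z r. D_c u)" "closed {(z, u). u \<in> D_c z}"
    using assms(9) unfolding conservative_jacobian_def conservative_for_def by simp_all
  note elm = assms(12)[unfolded elm_iterates_def]
  have \<eta>: "\<And>k. 0 \<le> \<eta> k" "\<eta> \<longlonglongrightarrow> 0" "bounded (range \<xi>)"
    using assms(20) by (auto simp: admissible_steps_noise_def less_imp_le)
  have \<delta>: "bounded (range \<delta>)" using assms(16) convergent_imp_bounded by blast
  have x: "bounded (range x)"
    using bounded_fst[OF assms(14)] by (simp add: image_image)
  have d: "bounded (range d)" and J: "bounded (range J)"
    by (rule bounded_expansion_sequence[OF D_f(1,2) x \<delta> assms(17)[rule_format]],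
        rule bounded_expansion_sequence[OF D_c(1,2) x \<delta> assms(18)[rule_format]])
  have w_tendsto: "(\<lambda>j. w (r j)) \<longlonglongrightarrow> c l"
    if "filterlim r at_top sequentially" "(\<lambda>j. x (r j)) \<longlonglongrightarrow> l" for r l
  proof -
    have "(\<lambda>j. w (r j) - c (x (r j))) \<longlonglongrightarrow> 0"
      by (rule Lim_null_comparison[OF always_eventually[OF allI] filterlim_compose[OF assms(16) that(1)]])
        (rule assms(19)[rule_format])
    moreover have "(\<lambda>j. c (x (r j))) \<longlonglongrightarrow> c l"
      by (rule locally_lipschitz_tendsto[OF c that(2)])
    ultimately show ?thesis using tendsto_add by fastforce
  qed
  have w: "bounded (range w)"
  proof -
    have "bounded (\<Union>z\<in>range x. {c z})"
    proof (rule locally_bounded_imp_bounded_UN[of UNIV])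
      fix z
      obtain r L where r: "0 < r" "L-lipschitz_on (ball z r) c"
        using c unfolding locally_lipschitz_def by blast
      then have "bounded (c ` ball z r)"
        using bounded_uniformly_continuous_image lipschitz_on_uniformly_continuous bounded_ball by blast
      with r(1) show "\<exists>r>0. bounded (\<Union>z'\<in>ball z r \<inter> UNIV. {c z'})"
        by (auto simp: UNION_singleton_eq_range)
    qed (use x in auto)
    then obtain K where K: "\<And>k. norm (c (x k)) \<le> K" unfolding bounded_iff by blast
    obtain L where L: "\<And>k. \<bar>\<delta> k\<bar> \<le> L" using \<delta> by (auto simp: bounded_iff)
    have "norm (w k) \<le> K + L" for k
      using norm_triangle_ineq[of "c (x k)" "w k - c (x k)"] K[of k] L[of k] assms(19)[rule_format, of k]
      by simp
    then show ?thesis by (auto simp: bounded_iff)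
  qed
  have \<theta>: "\<And>k. \<theta>_min \<le> \<theta> k" "\<And>k. \<theta> k \<le> \<beta>"
    using assms(23,24) by (auto intro: order_trans less_imp_le)
  have lam_rec: "\<And>k. lam (Suc k) = lam k + \<theta> k *\<^sub>R (regu (w (Suc k)) - (1 / \<beta>) *\<^sub>R lam k)"
    using elm by blast
  note mult = bounded_bilinear_matrix_vector_mult[where 'm='p and 'n='n]
  have v: "bounded (range (\<lambda>k. lam k + \<rho> *\<^sub>R w k))"
    using bounded_multiplier[of \<beta> \<theta>_min \<theta> lam w, OF assms(4,21) \<theta> lam_rec] w
    by (intro bounded_plus_comp bounded_scaleR_comp)
  have Jv: "bounded (range (\<lambda>k. J k *v (lam k + \<rho> *\<^sub>R w k)))"
  proof -
    obtain A B where AB: "\<And>k. norm (J k) \<le> A" "\<And>k. norm (lam k + \<rho> *\<^sub>R w k) \<le> B"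
      using J v by (auto simp: bounded_iff)
    obtain K where K: "0 \<le> K" "\<And>(M :: real^'p^'n) u. norm (M *v u) \<le> norm M * norm u * K"
      using bounded_bilinear.nonneg_bounded[OF mult] by blast
    have "norm (J k *v (lam k + \<rho> *\<^sub>R w k)) \<le> A * B * K" for k
      using AB K(1)
      by (intro order_trans[OF K(2)] mult_right_mono mult_mono) (auto intro: order_trans[OF norm_ge_zero])
    then show ?thesis by (auto simp: bounded_iff)
  qed
  have \<xi>': "bounded (range (\<lambda>k. \<xi> (Suc k)))" by (rule bounded_subset[OF \<eta>(3)]) auto
  have increments: "(\<lambda>k. x (Suc k) - x k) \<longlonglongrightarrow> 0"
  proof (rule embeddable_method_increments[OF assms(6,2)])
    show "(x (Suc k), y (Suc k)) \<in> \<Phi> k (d k + J k *v (lam k + \<rho> *\<^sub>R w k) + \<xi> (Suc k)) (x k) (y k) (\<eta> k)" for k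
      using elm by blast
    show "bounded (range (\<lambda>k. d k + J k *v (lam k + \<rho> *\<^sub>R w k) + \<xi> (Suc k)))"
      by (intro bounded_plus_comp d Jv \<xi>')
  qed (use assms(13,14) \<eta> in auto)
  have idx: "filterlim idx at_top sequentially" "(\<lambda>j. x (idx j)) \<longlonglongrightarrow> xbar" "(\<lambda>j. \<delta> (idx j)) \<longlonglongrightarrow> 0"
    using assms(25,26) filterlim_compose[OF assms(16)] by auto
  have "(\<lambda>j. infdist (lam (idx j)) ((*\<^sub>R) \<beta> ` regu_set (c xbar))) \<longlonglongrightarrow> 0"
    by (rule multiplier_tendsto[where lam = lam and w = w and x = x and l = xbar and y = "c xbar",
          OF assms(4,21) \<theta> lam_rec increments w_tendsto idx(1,2)])
  then obtain p where p: "\<forall>j. p j \<in> (*\<^sub>R) \<beta> ` regu_set (c xbar)" "(\<lambda>j. lam (idx j) - p j) \<longlonglongrightarrow> 0"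
    using obtain_nearby_sequence[of "(*\<^sub>R) \<beta> ` regu_set (c xbar)" "\<lambda>j. lam (idx j)"]
      regu_in_regu_set[of "c xbar"] by blast
  have "(\<lambda>j. infdist (d (idx j)) (D_f xbar)) \<longlonglongrightarrow> 0"
    by (rule expansion_tendsto[OF D_f(3,1,2) idx(2,3) assms(17)[rule_format]])
  then obtain d' where d': "\<forall>j. d' j \<in> D_f xbar" "(\<lambda>j. d (idx j) - d' j) \<longlonglongrightarrow> 0"
    using obtain_nearby_sequence[of "D_f xbar" "\<lambda>j. d (idx j)"] D_f(1) by blast
  have "(\<lambda>j. infdist (J (idx j)) (D_c xbar)) \<longlonglongrightarrow> 0"
    by (rule expansion_tendsto[OF D_c(3,1,2) idx(2,3) assms(18)[rule_format]])
  then obtain J' where J': "\<forall>j. J' j \<in> D_c xbar" "(\<lambda>j. J (idx j) - J' j) \<longlonglongrightarrow> 0"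
    using obtain_nearby_sequence[of "D_c xbar" "\<lambda>j. J (idx j)"] D_c(1) by blast
  let ?v = "\<lambda>j. lam (idx j) + \<rho> *\<^sub>R w (idx j)" and ?v' = "\<lambda>j. p j + \<rho> *\<^sub>R c xbar"
  let ?g = "\<lambda>j. d (idx j) + J (idx j) *v ?v j" and ?g' = "\<lambda>j. d' j + J' j *v ?v' j"
  have in_field: "?g' j \<in> penalty_field \<beta> \<rho> c D_f D_c xbar" for j
  proof -
    obtain u where "u \<in> regu_set (c xbar)" "p j = \<beta> *\<^sub>R u" using p(1) by blast
    then have "?v' j \<in> (\<lambda>u. \<beta> *\<^sub>R u + \<rho> *\<^sub>R c xbar) ` regu_set (c xbar)"
      by (intro image_eqI[where x = u]) simp_all
    then show ?thesis
      unfolding penalty_field_def using d'(1) J'(1) by (intro hull_inc set_plus_intro) blast+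
  qed
  have v': "(\<lambda>j. ?v j - ?v' j) \<longlonglongrightarrow> 0"
  proof -
    have "(\<lambda>j. (lam (idx j) - p j) + \<rho> *\<^sub>R (w (idx j) - c xbar)) \<longlonglongrightarrow> 0 + \<rho> *\<^sub>R (c xbar - c xbar)"
      by (intro tendsto_intros p(2) w_tendsto[OF idx(1,2)])
    then show ?thesis by (simp add: algebra_simps)
  qed
  obtain B where B: "\<And>k. norm (lam k + \<rho> *\<^sub>R w k) \<le> B" using v by (auto simp: bounded_iff)
  have "bounded (D_c xbar)"
  proof -
    obtain r where "0 < r" "bounded (\<Union>u\<in>ball xbar r. D_c u)" using D_c(2) by blast
    then show ?thesis
      using UN_upper[of xbar "ball xbar r" D_c] bounded_subset by simp
  qed
  then obtain A where A: "\<And>j. norm (J' j) \<le> A" using J'(1) by (auto simp: bounded_iff)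
  have Bfun: "Bfun ?v sequentially" "Bfun J' sequentially"
    by (rule BfunI[OF always_eventually, rule_format], rule B,
        rule BfunI[OF always_eventually, rule_format], rule A)
  \<comment> \<open>Matrix and vector factor are replaced one at a time, so that each error is a null sequence
    times a bounded one.\<close>
  have "(\<lambda>j. (J (idx j) - J' j) *v ?v j) \<longlonglongrightarrow> 0"
    using bounded_bilinear.Zfun_prod_Bfun[OF mult, of "\<lambda>j. J (idx j) - J' j" sequentially ?v] J'(2) Bfun(1)
    by (simp add: tendsto_Zfun_iff)
  moreover have "(\<lambda>j. J' j *v (?v j - ?v' j)) \<longlonglongrightarrow> 0"
    using bounded_bilinear.Bfun_prod_Zfun[OF mult, of J' sequentially "\<lambda>j. ?v j - ?v' j"] v' Bfun(2)
    by (simp add: tendsto_Zfun_iff)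
  ultimately have lim: "(\<lambda>j. (d (idx j) - d' j) + ((J (idx j) - J' j) *v ?v j + J' j *v (?v j - ?v' j)))
      \<longlonglongrightarrow> 0 + (0 + 0)"
    by (intro tendsto_add d'(2))
  have "(a - b) + ((M - N) *v u + N *v (u - v)) = (a + M *v u) - (b + N *v v)"
    for a b :: "real^'n" and M N :: "real^'p^'n" and u v
    by (simp add: matrix_vector_mult_diff_rdistrib matrix_vector_mult_diff_distrib)
  with lim have "(\<lambda>j. ?g j - ?g' j) \<longlonglongrightarrow> 0" by (simp only: add_0)
  then have "(\<lambda>j. norm (?g j - ?g' j)) \<longlonglongrightarrow> 0" by (rule tendsto_norm_zero)
  then show ?thesis
  proof (rule Lim_null_comparison[rotated])
    show "\<forall>\<^sub>F j in sequentially. norm (infdist (?g j) (penalty_field \<beta> \<rho> c D_f D_c xbar)) \<le> norm (?g j - ?g' j)"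
      using infdist_le[OF in_field] by (auto intro!: always_eventually simp: infdist_nonneg simp flip: dist_norm)
  qed
qed

end
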